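(* Any finite nonempty (strictly) increasing sequence of positive integers is the sequence of relative generalized Hamming weights of a pair of nested linear block codes. In addition, let $n,k_1,k_2$ be integers with $0\leq k_2<k_1\leq n$, let $1\leq d_1<d_2<\cdots<d_{k_1-k_2}$ be integers, and let $q$ be a prime power such that $q\geq n-k_2\geq d_{k_1-k_2}$. Then there exists a pair of nested linear block codes $\mathcal{C}_2\subsetneq\mathcal{C}_1\subseteq\mathbb{F}_q^n$ with $\dim(\mathcal{C}_1)=k_1$, $\dim(\mathcal{C}_2)=k_2$ and $d_r(\mathcal{C}_1,\mathcal{C}_2)=d_r$ for all $1\leq r\leq k_1-k_2$. Moreover, the pair may always be chosen such that it satisfies the relative chain condition. In particular, any increasing sequence of positive integers is the sequence of relative greedy weights of a pair of nested linear block codes.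
   Context: A linear block code is an $\mathbb{F}_q$-linear subspace of $\mathbb{F}_q^n$, with $q$ a prime power; a subcode is a linear subspace of a code. For a linear subspace $\mathcal{D}\subseteq\mathbb{F}_q^n$, $\mathrm{supp}(\mathcal{D})=\{i\in\{1,\ldots,n\} : c_i\neq 0\text{ for some }c\in\mathcal{D}\}$ and $\mathrm{wt}(\mathcal{D})=|\mathrm{supp}(\mathcal{D})|$. Let $\mathcal{C}_2\subsetneq\mathcal{C}_1\subseteq\mathbb{F}_q^n$ be nested codes with $k_j=\dim(\mathcal{C}_j)$, $j=1,2$. For $1\leq r\leq k_1-k_2$ the $r$-th relative generalized Hamming weight of the pair is $$d_r(\mathcal{C}_1,\mathcal{C}_2)=\min\{|\mathrm{supp}(\mathcal{D})| : \mathcal{D}\text{ is a subcode of }\mathcal{C}_1,\ \mathcal{D}\cap\mathcal{C}_2=0,\ \dim(\mathcal{D})\geq r\}.$$ The sequence of relative generalized Hamming weights of the pair is $d_1(\mathcal{C}_1,\mathcal{C}_2),\ldots,d_{k_1-k_2}(\mathcal{C}_1,\mathcal{C}_2)$. Relative chain condition: the pair satisfies the relative chain condition if there exists a chain of subcodes $0\subsetneq\mathcal{D}_1\subsetneq\mathcal{D}_2\subsetneq\cdots\subsetneq\mathcal{D}_{k_1-k_2}\subseteq\mathcal{C}_1$ such that $\mathcal{D}_r\cap\mathcal{C}_2=0$ and $\mathrm{wt}(\mathcal{D}_r)=d_r(\mathcal{C}_1,\mathcal{C}_2)$ for all $1\leq r\leq k_1-k_2$. Relative greedy weights: a relative greedy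 $1$-subcode is a $1$-dimensional subcode $\mathcal{D}_1\subseteq\mathcal{C}_1$ with $\mathcal{D}_1\cap\mathcal{C}_2=0$ and $\mathrm{wt}(\mathcal{D}_1)=d_1(\mathcal{C}_1,\mathcal{C}_2)$. For $2\leq r\leq k_1-k_2$, a relative greedy $r$-subcode is an $r$-dimensional subcode $\mathcal{D}_r\subseteq\mathcal{C}_1$ with $\mathcal{D}_r\cap\mathcal{C}_2=0$ of minimum weight among those $r$-dimensional subcodes of $\mathcal{C}_1$ that intersect $\mathcal{C}_2$ trivially and contain a relative greedy $(r-1)$-subcode. The $r$-th relative greedy weight is $g_r(\mathcal{C}_1,\mathcal{C}_2)=\mathrm{wt}(\mathcal{D}_r)$ for any relative greedy $r$-subcode $\mathcal{D}_r$; the sequence of relative greedy weights is $g_1(\mathcal{C}_1,\mathcal{C}_2),\ldots,g_{k_1-k_2}(\mathcal{C}_1,\mathcal{C}_2)$. *)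

theory Defs
  imports
    "Jordan_Normal_Form.Missing_VectorSpace"
    "HOL-Number_Theory.Number_Theory"
begin

text \<open>
  Finite fields are HOL-Algebra records, so that the field can be quantified existentially.
  Words of length n over F are functions in \<open>{1..n} \<rightarrow>\<^sub>E carrier F\<close>; subspaces and
  dimension are those of the AFP entry VectorSpace. There \<open>VectorSpace.subspace F C V\<close> includes that
  V is a vector space over the field F.
\<close>

abbreviation word_space :: "'a ring \<Rightarrow> nat \<Rightarrow> ('a, nat \<Rightarrow> 'a) module" where
  "word_space F n \<equiv> ring.func_space F {1..n}"

abbreviation zero_code :: "'a ring \<Rightarrow> nat \<Rightarrow> (nat \<Rightarrow> 'a) set" where
  "zero_code F n \<equiv> {\<zero>\<^bsub>word_space F n\<^esub>}"

definition linear_code :: "'a ring \<Rightarrow> nat \<Rightarrow> (nat \<Rightarrow> 'a) set \<Rightarrow> bool" where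
  "linear_code F n C \<longleftrightarrow> finite (carrier F) \<and> VectorSpace.subspace F C (word_space F n)"

definition subcode :: "'a ring \<Rightarrow> nat \<Rightarrow> (nat \<Rightarrow> 'a) set \<Rightarrow> (nat \<Rightarrow> 'a) set \<Rightarrow> bool" where
  "subcode F n D C \<longleftrightarrow> linear_code F n D \<and> D \<subseteq> C"

definition code_dim :: "'a ring \<Rightarrow> nat \<Rightarrow> (nat \<Rightarrow> 'a) set \<Rightarrow> nat" where
  "code_dim F n C = vectorspace.dim F ((word_space F n)\<lparr>carrier := C\<rparr>)"

definition supp :: "'a ring \<Rightarrow> nat \<Rightarrow> (nat \<Rightarrow> 'a) set \<Rightarrow> nat set" where
  "supp F n D = {i \<in> {1..n}. \<exists>c\<in>D. c i \<noteq> \<zero>\<^bsub>F\<^esub>}"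

definition wt :: "'a ring \<Rightarrow> nat \<Rightarrow> (nat \<Rightarrow> 'a) set \<Rightarrow> nat" where
  "wt F n D = card (supp F n D)"

definition nested_codes :: "'a ring \<Rightarrow> nat \<Rightarrow> (nat \<Rightarrow> 'a) set \<Rightarrow> (nat \<Rightarrow> 'a) set \<Rightarrow> bool" where
  "nested_codes F n C1 C2 \<longleftrightarrow> linear_code F n C1 \<and> linear_code F n C2 \<and> C2 \<subset> C1"

text \<open>The following notions are meaningful for nested codes and indices between 1 and
  \<open>code_dim F n C1 - code_dim F n C2\<close>.\<close>

definition rghw :: "'a ring \<Rightarrow> nat \<Rightarrow> (nat \<Rightarrow> 'a) set \<Rightarrow> (nat \<Rightarrow> 'a) set \<Rightarrow> nat \<Rightarrow> nat" where
  "rghw F n C1 C2 r =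
     Min {card (supp F n D) | D. subcode F n D C1 \<and> D \<inter> C2 = zero_code F n \<and> code_dim F n D \<ge> r}"

definition rghw_seq :: "'a ring \<Rightarrow> nat \<Rightarrow> (nat \<Rightarrow> 'a) set \<Rightarrow> (nat \<Rightarrow> 'a) set \<Rightarrow> nat list" where
  "rghw_seq F n C1 C2 = map (rghw F n C1 C2) [1..<Suc (code_dim F n C1 - code_dim F n C2)]"

definition relative_chain_condition ::
  "'a ring \<Rightarrow> nat \<Rightarrow> (nat \<Rightarrow> 'a) set \<Rightarrow> (nat \<Rightarrow> 'a) set \<Rightarrow> bool" where
  "relative_chain_condition F n C1 C2 \<longleftrightarrow>
     (let m = code_dim F n C1 - code_dim F n C2 in
      \<exists>D :: nat \<Rightarrow> (nat \<Rightarrow> 'a) set.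
        zero_code F n \<subset> D 1 \<and>
        (\<forall>r\<in>{1..<m}. D r \<subset> D (Suc r)) \<and>
        (\<forall>r\<in>{1..m}. subcode F n (D r) C1 \<and> D r \<inter> C2 = zero_code F n \<and>
                     wt F n (D r) = rghw F n C1 C2 r))"

text \<open>Index 0 is a dummy case: greedy subcodes start at index 1.\<close>

fun greedy_subcode ::
  "'a ring \<Rightarrow> nat \<Rightarrow> (nat \<Rightarrow> 'a) set \<Rightarrow> (nat \<Rightarrow> 'a) set \<Rightarrow> nat \<Rightarrow> (nat \<Rightarrow> 'a) set \<Rightarrow> bool" where
  "greedy_subcode F n C1 C2 0 D \<longleftrightarrow> False"
| "greedy_subcode F n C1 C2 (Suc 0) D \<longleftrightarrow>
     subcode F n D C1 \<and> code_dim F n D = 1 \<and> D \<inter> C2 = zero_code F n \<and>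
     wt F n D = rghw F n C1 C2 1"
| "greedy_subcode F n C1 C2 (Suc (Suc r)) D \<longleftrightarrow>
     is_arg_min (wt F n)
       (\<lambda>D'. subcode F n D' C1 \<and> code_dim F n D' = Suc (Suc r) \<and> D' \<inter> C2 = zero_code F n \<and>
             (\<exists>E. greedy_subcode F n C1 C2 (Suc r) E \<and> E \<subseteq> D'))
       D"

text \<open>All greedy r-subcodes have the same weight, so the description is well defined.\<close>

definition greedy_weight ::
  "'a ring \<Rightarrow> nat \<Rightarrow> (nat \<Rightarrow> 'a) set \<Rightarrow> (nat \<Rightarrow> 'a) set \<Rightarrow> nat \<Rightarrow> nat" where
  "greedy_weight F n C1 C2 r = (THE w. \<exists>D. greedy_subcode F n C1 C2 r D \<and> w = wt F n D)"

definition greedy_weight_seq ::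
  "'a ring \<Rightarrow> nat \<Rightarrow> (nat \<Rightarrow> 'a) set \<Rightarrow> (nat \<Rightarrow> 'a) set \<Rightarrow> nat list" where
  "greedy_weight_seq F n C1 C2 =
     map (greedy_weight F n C1 C2) [1..<Suc (code_dim F n C1 - code_dim F n C2)]"

end

theory Submission
  imports Defs "HOL-Algebra.Multiplicative_Group"
begin

text \<open>
  Put \<open>N = n - k2\<close> and choose distinct field elements \<open>x 1, \<dots>, x N\<close>. For \<open>i \<le> m = k1 - k2\<close>
  let \<open>P i\<close> be the monic polynomial of degree \<open>N - d i\<close> whose roots are the \<open>x t\<close> with
  \<open>d i < t \<le> N\<close>. The code C2 is spanned by the last k2 unit vectors, and C1 is the sum of C2 and
  the span of the evaluation vectors of the \<open>P i\<close>. The first r evaluation vectors are supported on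
  \<open>{1..d r}\<close>. Conversely, a subcode E of dimension at least r meets the span of C2 and the
  evaluations of \<open>P r, \<dots>, P m\<close> nontrivially, by dimension. If E meets C2 trivially, the common
  element comes from a nonzero polynomial of degree at most \<open>N - d r\<close>, hence has weight at least
  \<open>d r\<close>. A chain attaining the relative generalized Hamming weights consists of greedy subcodes,
  so the greedy weights are the same. Dimensions are computed from cardinalities.
\<close>

section \<open>Polynomial functions\<close>

definition (in domain) poly_fun :: "nat \<Rightarrow> ('a \<Rightarrow> 'a) \<Rightarrow> bool" where
  "poly_fun s f \<longleftrightarrow>
     (\<exists>p\<in>carrier (UP R). deg R p \<le> s \<and> (\<forall>x\<in>carrier R. f x = eval R R id x p))"

context domain
begin

lemma poly_funI:
  "\<lbrakk>p \<in> carrier (UP R); deg R p \<le> s; \<And>x. x \<in> carrier R \<Longrightarrow> f x = eval R R id x p\<rbrakk>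
    \<Longrightarrow> poly_fun s f"
  unfolding poly_fun_def by blast

lemma poly_fun_mono: "poly_fun s f \<Longrightarrow> s \<le> t \<Longrightarrow> poly_fun t f"
  unfolding poly_fun_def by (meson le_trans)

lemma poly_fun_cong:
  "poly_fun s f \<Longrightarrow> (\<And>x. x \<in> carrier R \<Longrightarrow> g x = f x) \<Longrightarrow> poly_fun s g"
  unfolding poly_fun_def by auto

lemma poly_fun_const:
  assumes "c \<in> carrier R"
  shows "poly_fun 0 (\<lambda>_. c)"
proof -
  interpret U: UP_domain R "UP R" by unfold_locales
  show ?thesis
    by (rule poly_funI[of "monom (UP R) c 0"]) (simp_all add: assms U.evalRR_monom)
qed

lemma poly_fun_add:
  assumes "poly_fun s f" "poly_fun s g"
  shows "poly_fun s (\<lambda>x. f x \<oplus> g x)"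
proof -
  interpret U: UP_domain R "UP R" by unfold_locales
  obtain p where p: "p \<in> carrier (UP R)" "deg R p \<le> s"
    "\<forall>x\<in>carrier R. f x = eval R R id x p"
    using assms(1) unfolding poly_fun_def by blast
  obtain q where q: "q \<in> carrier (UP R)" "deg R q \<le> s"
    "\<forall>x\<in>carrier R. g x = eval R R id x q"
    using assms(2) unfolding poly_fun_def by blast
  show ?thesis
  proof (rule poly_funI[of "p \<oplus>\<^bsub>UP R\<^esub> q"])
    show "deg R (p \<oplus>\<^bsub>UP R\<^esub> q) \<le> s"
      using U.deg_add[OF p(1) q(1)] p(2) q(2) by linarith
  qed (use p q in \<open>simp_all add: U.evalRR_add\<close>)
qed

lemma poly_fun_mult:
  assumes "poly_fun s f" "poly_fun t g"
  shows "poly_fun (s + t) (\<lambda>x. f x \<otimes> g x)"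
proof -
  interpret U: UP_domain R "UP R" by unfold_locales
  obtain p where p: "p \<in> carrier (UP R)" "deg R p \<le> s"
    "\<forall>x\<in>carrier R. f x = eval R R id x p"
    using assms(1) unfolding poly_fun_def by blast
  obtain q where q: "q \<in> carrier (UP R)" "deg R q \<le> t"
    "\<forall>x\<in>carrier R. g x = eval R R id x q"
    using assms(2) unfolding poly_fun_def by blast
  show ?thesis
  proof (rule poly_funI[of "p \<otimes>\<^bsub>UP R\<^esub> q"])
    show "deg R (p \<otimes>\<^bsub>UP R\<^esub> q) \<le> s + t"
      using U.deg_mult_ring[OF p(1) q(1)] p(2) q(2) by linarith
  qed (use p q in \<open>simp_all add: U.evalRR_mult\<close>)
qed

lemma poly_fun_linear:
  assumes "b \<in> carrier R"
  shows "poly_fun 1 (\<lambda>x. x \<ominus> b)"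
proof -
  interpret U: UP_domain R "UP R" by unfold_locales
  have "poly_fun 1 (\<lambda>x. x)"
    by (rule poly_funI[of "monom (UP R) \<one> 1"]) (simp_all add: U.evalRR_monom)
  moreover have "poly_fun 1 (\<lambda>_. \<ominus> b)"
    using poly_fun_const[of "\<ominus> b"] assms by (auto intro: poly_fun_mono)
  ultimately have "poly_fun 1 (\<lambda>x. x \<oplus> \<ominus> b)"
    by (rule poly_fun_add)
  then show ?thesis
    by (simp add: a_minus_def)
qed

lemma poly_fun_finsum:
  assumes "finite I" "\<And>i. i \<in> I \<Longrightarrow> poly_fun s (f i)"
    "\<And>i x. i \<in> I \<Longrightarrow> x \<in> carrier R \<Longrightarrow> f i x \<in> carrier R"
  shows "poly_fun s (\<lambda>x. \<Oplus>i\<in>I. f i x)"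
  using assms
proof (induction I rule: finite_induct)
  case empty
  then show ?case
    by (auto intro: poly_fun_mono[OF poly_fun_const[OF zero_closed]])
next
  case (insert i I)
  have "poly_fun s (\<lambda>x. f i x \<oplus> (\<Oplus>j\<in>I. f j x))"
    using insert by (intro poly_fun_add) auto
  then show ?case
    by (rule poly_fun_cong) (use insert in \<open>auto intro!: finsum_insert\<close>)
qed

lemma poly_fun_finprod:
  assumes "finite I" "\<And>i. i \<in> I \<Longrightarrow> poly_fun 1 (f i)"
    "\<And>i x. i \<in> I \<Longrightarrow> x \<in> carrier R \<Longrightarrow> f i x \<in> carrier R"
  shows "poly_fun (card I) (\<lambda>x. \<Otimes>i\<in>I. f i x)"
  using assms
proof (induction I rule: finite_induct)
  case empty
  then show ?case
    using poly_fun_const[OF one_closed] by simp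
next
  case (insert i I)
  have "poly_fun (1 + card I) (\<lambda>x. f i x \<otimes> (\<Otimes>j\<in>I. f j x))"
    using insert by (intro poly_fun_mult) auto
  then have "poly_fun (1 + card I) (\<lambda>x. \<Otimes>j\<in>insert i I. f j x)"
    by (rule poly_fun_cong) (use insert in \<open>auto intro!: finprod_insert\<close>)
  then show ?case
    using insert.hyps by simp
qed

text \<open>Over a finite field a nonzero polynomial may vanish everywhere, so a point
  \<open>y\<close> with nonzero value is demanded. It forces the representing polynomial to be
  nonzero, and the root bound applies.\<close>

lemma poly_fun_card_roots_le:
  assumes "finite (carrier R)" "poly_fun s f" "y \<in> carrier R" "f y \<noteq> \<zero>"
  shows "card {x \<in> carrier R. f x = \<zero>} \<le> s"
proof -
  interpret U: UP_domain R "UP R" by unfold_locales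
  obtain p where p: "p \<in> carrier (UP R)" "deg R p \<le> s"
    "\<forall>x\<in>carrier R. f x = eval R R id x p"
    using assms(2) unfolding poly_fun_def by blast
  \<comment> \<open>The zero polynomial is read as the monomial with coefficient
    \<open>\<zero>\<close> and exponent 0.\<close>
  have "eval R R id y \<zero>\<^bsub>UP R\<^esub> = \<zero>"
    using U.evalRR_monom[OF zero_closed assms(3), of 0] by simp
  then have "p \<noteq> \<zero>\<^bsub>UP R\<^esub>"
    using assms(3,4) p(3) by auto
  then have "card {x \<in> carrier R. eval R R id x p = \<zero>} \<le> s"
    using U.roots_bound[OF p(1) _ assms(1)] p(2) by auto
  moreover have "{x \<in> carrier R. f x = \<zero>} = {x \<in> carrier R. eval R R id x p = \<zero>}"
    using p(3) by auto
  ultimately show ?thesis by simp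
qed

end

section \<open>Codes over a finite field\<close>

text \<open>Coordinates with respect to a finite basis identify vectors with coefficient
  families.\<close>

lemma (in vectorspace) card_carrier_eq_power_dim:
  assumes "finite (carrier K)" "finite (carrier V)"
  shows "card (carrier V) = card (carrier K) ^ dim"
proof -
  \<comment> \<open>The finite carrier is itself a generating set.\<close>
  have "fin_dim"
    unfolding fin_dim_def
    using assms(2) span_is_subset2 in_own_span by blast
  then obtain B where B: "finite B" "basis B"
    using finite_basis_exists by blast
  have BV: "B \<subseteq> carrier V"
    using B(2) by (simp add: basis_def)
  have uniq: "\<exists>!a. a \<in> B \<rightarrow>\<^sub>E carrier K \<and> lincomb a B = v" if "v \<in> carrier V" for v
    using basis_criterion[OF B(1) BV] B(2) that by blast
  have closed: "lincomb a B \<in> carrier V" if "a \<in> B \<rightarrow>\<^sub>E carrier K" for a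
    using lincomb_closed[OF BV] that by (auto simp: PiE_def)
  have "bij_betw (\<lambda>a. lincomb a B) (B \<rightarrow>\<^sub>E carrier K) (carrier V)"
    unfolding bij_betw_def inj_on_def using uniq closed by (auto simp: image_iff) metis+
  then have "card (carrier V) = card (B \<rightarrow>\<^sub>E carrier K)"
    by (simp add: bij_betw_same_card)
  also have "\<dots> = card (carrier K) ^ card B"
    by (simp add: card_PiE B(1))
  finally show ?thesis
    using dim_basis[OF B] by simp
qed

locale finite_field = field F for F :: "'a ring" (structure) +
  assumes finite_carrier [simp]: "finite (carrier F)"
begin

lemma word_space_vectorspace: "vectorspace F (word_space F n)"
proof -
  have "Module.module F (func_space {1..n})"
    by (rule func_space_is_module)
  then show ?thesis
    by (simp add: vectorspace_def module_def field_axioms)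
qed

lemma card_carrier_gt_1: "1 < card (carrier F)"
proof -
  have "card {\<zero>, \<one>} \<le> card (carrier F)"
    by (rule card_mono) auto
  then show ?thesis by simp
qed

text \<open>Allows closure to be checked coordinate by coordinate; the restrictions to
  \<open>{1..n}\<close> keep words extensional.\<close>

lemma linear_code_iff:
  "linear_code F n C \<longleftrightarrow>
     C \<subseteq> {1..n} \<rightarrow>\<^sub>E carrier F \<and> (\<lambda>j\<in>{1..n}. \<zero>) \<in> C \<and>
     (\<forall>v\<in>C. \<forall>w\<in>C. (\<lambda>j\<in>{1..n}. v j \<oplus> w j) \<in> C) \<and>
     (\<forall>c\<in>carrier F. \<forall>v\<in>C. (\<lambda>j\<in>{1..n}. c \<otimes> v j) \<in> C)"
  using word_space_vectorspace[of n]
  by (auto simp: linear_code_def VectorSpace.subspace_def LinearCombinations.submodule_def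
      vectorspace_def func_space_def)

lemma linear_code_finite: "linear_code F n C \<Longrightarrow> finite C"
  unfolding linear_code_iff by (meson finite_PiE finite_atLeastAtMost finite_carrier finite_subset)

lemma card_linear_code:
  assumes "linear_code F n C"
  shows "card C = card (carrier F) ^ code_dim F n C"
proof -
  interpret W: vectorspace F "word_space F n"
    by (rule word_space_vectorspace)
  interpret C: vectorspace F "(word_space F n)\<lparr>carrier := C\<rparr>"
    using assms W.subspace_is_vs by (simp add: linear_code_def)
  show ?thesis
    using C.card_carrier_eq_power_dim linear_code_finite[OF assms] by (simp add: code_dim_def)
qed

lemma code_dim_eqI:
  assumes "linear_code F n C" "card C = card (carrier F) ^ k"
  shows "code_dim F n C = k"
  using assms card_linear_code card_carrier_gt_1 power_inject_exp by metis

lemma zero_code_eq: "zero_code F n = {\<lambda>j\<in>{1..n}. \<zero>}"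
  by (simp add: func_space_def)

lemma linear_code_diff:
  assumes "linear_code F n C" "v \<in> C" "w \<in> C"
  shows "(\<lambda>j\<in>{1..n}. v j \<ominus> w j) \<in> C"
proof -
  have "(\<lambda>j\<in>{1..n}. v j \<oplus> (\<lambda>j\<in>{1..n}. \<ominus> \<one> \<otimes> w j) j) \<in> C"
    using assms unfolding linear_code_iff by blast
  moreover have "(\<lambda>j\<in>{1..n}. v j \<oplus> (\<lambda>j\<in>{1..n}. \<ominus> \<one> \<otimes> w j) j) = (\<lambda>j\<in>{1..n}. v j \<ominus> w j)"
  proof (rule restrict_ext)
    fix j assume "j \<in> {1..n}"
    then have "w j \<in> carrier F"
      using assms(1,3) unfolding linear_code_iff by (meson PiE_mem subsetD)
    then show "v j \<oplus> (\<lambda>j\<in>{1..n}. \<ominus> \<one> \<otimes> w j) j = v j \<ominus> w j"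
      using \<open>j \<in> {1..n}\<close> by (simp add: a_minus_def l_minus)
  qed
  ultimately show ?thesis by simp
qed

text \<open>If D and W met trivially, addition would embed \<open>D \<times> W\<close> into C.\<close>

lemma subcodes_meet_nontrivially:
  assumes "linear_code F n C" "subcode F n D C" "subcode F n W C"
    "code_dim F n C < code_dim F n D + code_dim F n W"
  obtains c where "c \<in> D" "c \<in> W" "c \<notin> zero_code F n"
proof (rule ccontr)
  assume *: "\<not> thesis"
  have D: "linear_code F n D" "D \<subseteq> C" and W: "linear_code F n W" "W \<subseteq> C"
    using assms by (simp_all add: subcode_def)
  let ?f = "\<lambda>(v, w). \<lambda>j\<in>{1..n}. v j \<oplus> w j"
  have word: "u \<in> {1..n} \<rightarrow>\<^sub>E carrier F" if "u \<in> C" for u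
    using assms(1) that unfolding linear_code_iff by blast
  have "inj_on ?f (D \<times> W)"
  proof (rule inj_onI)
    fix x y assume "x \<in> D \<times> W" "y \<in> D \<times> W" "?f x = ?f y"
    then obtain v w v' w' where xy: "x = (v, w)" "y = (v', w')"
      and vw: "v \<in> D" "w \<in> W" "v' \<in> D" "w' \<in> W"
      and eq: "(\<lambda>j\<in>{1..n}. v j \<oplus> w j) = (\<lambda>j\<in>{1..n}. v' j \<oplus> w' j)"
      by (cases x; cases y) simp
    have words: "v \<in> {1..n} \<rightarrow>\<^sub>E carrier F" "w \<in> {1..n} \<rightarrow>\<^sub>E carrier F"
      "v' \<in> {1..n} \<rightarrow>\<^sub>E carrier F" "w' \<in> {1..n} \<rightarrow>\<^sub>E carrier F"
      using vw D W word by auto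
    have cl: "v j \<in> carrier F" "w j \<in> carrier F" "v' j \<in> carrier F" "w' j \<in> carrier F"
      if "j \<in> {1..n}" for j
      using words that by auto
    have sum_eq: "v j \<oplus> w j = v' j \<oplus> w' j" if "j \<in> {1..n}" for j
      using fun_cong[OF eq, of j] that by simp
    \<comment> \<open>Two pairs with the same sum have \<open>v - v' = w' - w\<close>; this word
      lies in both D and W, hence is zero.\<close>
    have diff_eq: "v j \<ominus> v' j = w' j \<ominus> w j" if "j \<in> {1..n}" for j
    proof -
      have "v j \<ominus> v' j = (v j \<oplus> w j) \<ominus> w j \<ominus> v' j"
        using cl[OF that] by (simp add: a_minus_def a_assoc r_neg)
      also have "\<dots> = (v' j \<oplus> \<ominus> v' j) \<oplus> (w' j \<oplus> \<ominus> w j)"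
        using cl[OF that] unfolding sum_eq[OF that] by (simp add: a_minus_def a_ac)
      also have "\<dots> = w' j \<ominus> w j"
        using cl[OF that] by (simp add: a_minus_def r_neg)
      finally show ?thesis .
    qed
    have "(\<lambda>j\<in>{1..n}. v j \<ominus> v' j) \<in> D"
      by (rule linear_code_diff[OF D(1) vw(1,3)])
    moreover have "(\<lambda>j\<in>{1..n}. v j \<ominus> v' j) \<in> W"
      using linear_code_diff[OF W(1) vw(4,2)] by (simp add: diff_eq cong: restrict_cong)
    ultimately have "(\<lambda>j\<in>{1..n}. v j \<ominus> v' j) \<in> zero_code F n"
      using * that by blast
    then have z: "(\<lambda>j\<in>{1..n}. v j \<ominus> v' j) = (\<lambda>j\<in>{1..n}. \<zero>)"
      unfolding zero_code_eq by blast
    have "v j = v' j" if "j \<in> {1..n}" for j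
      using fun_cong[OF z, of j] that cl[OF that] by simp
    moreover from this have "w j = w' j" if "j \<in> {1..n}" for j
      using sum_eq[OF that] that cl[OF that] by (metis a_comm add.right_cancel)
    ultimately show "x = y"
      using words xy by (metis PiE_ext)
  qed
  moreover have "?f ` (D \<times> W) \<subseteq> C"
    using assms(1) D(2) W(2) unfolding linear_code_iff by auto blast
  ultimately have "card (D \<times> W) \<le> card C"
    using linear_code_finite[OF assms(1)] card_inj_on_le by blast
  then have "card (carrier F) ^ (code_dim F n D + code_dim F n W) \<le> card (carrier F) ^ code_dim F n C"
    using card_linear_code D(1) W(1) assms(1) by (simp add: card_cartesian_product power_add)
  then show False
    using assms(4) card_carrier_gt_1 by (meson leD power_strict_increasing)
qed

section \<open>Weights, their relative minima and greedy subcodes\<close>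

lemma wt_le: "wt F n D \<le> n"
proof -
  have "card (supp F n D) \<le> card {1..n}"
    by (rule card_mono) (auto simp: supp_def)
  then show ?thesis by (simp add: wt_def)
qed

text \<open>All weights are at most \<open>n\<close>, so the minimum is over a finite set, and
  \<open>D\<close> attains it.\<close>

lemma rghw_eqI:
  assumes "subcode F n D C1" "D \<inter> C2 = zero_code F n" "r \<le> code_dim F n D"
    "\<And>E. \<lbrakk>subcode F n E C1; E \<inter> C2 = zero_code F n; r \<le> code_dim F n E\<rbrakk> \<Longrightarrow> wt F n D \<le> wt F n E"
  shows "rghw F n C1 C2 r = wt F n D"
  unfolding rghw_def
proof (rule Min_eqI)
  show "finite {card (supp F n D) |D. subcode F n D C1 \<and> D \<inter> C2 = zero_code F n \<and> r \<le> code_dim F n D}"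
    by (rule finite_subset[of _ "{..n}"]) (auto simp: wt_le[unfolded wt_def])
qed (use assms in \<open>auto simp: wt_def\<close>)

lemma rghw_le_wt:
  assumes "subcode F n D C1" "D \<inter> C2 = zero_code F n" "r \<le> code_dim F n D"
  shows "rghw F n C1 C2 r \<le> wt F n D"
  unfolding rghw_def
proof (rule Min_le)
  show "finite {card (supp F n D) |D. subcode F n D C1 \<and> D \<inter> C2 = zero_code F n \<and> r \<le> code_dim F n D}"
    by (rule finite_subset[of _ "{..n}"]) (auto simp: wt_le[unfolded wt_def])
qed (use assms in \<open>auto simp: wt_def\<close>)

text \<open>A competitor for a greedy \<open>r\<close>-subcode has dimension \<open>r\<close> and
  meets \<open>C2\<close> trivially, so its weight is at least \<open>rghw F n C1 C2 r\<close>. The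
  code \<open>D r\<close> attains this bound and contains the greedy subcode
  \<open>D (r - 1)\<close> when \<open>r \<ge> 2\<close>.\<close>

lemma greedy_weight_eq_rghw:
  assumes chain: "\<And>r. r \<in> {1..m} \<Longrightarrow> subcode F n (D r) C1 \<and> D r \<inter> C2 = zero_code F n \<and>
      code_dim F n (D r) = r \<and> wt F n (D r) = rghw F n C1 C2 r"
    and incr: "\<And>r. r \<in> {1..<m} \<Longrightarrow> D r \<subseteq> D (Suc r)"
    and r: "r \<in> {1..m}"
  shows "greedy_weight F n C1 C2 r = rghw F n C1 C2 r"
proof -
  \<comment> \<open>The second conjunct provides the uniqueness that the definite description in
    \<open>greedy_weight\<close> requires.\<close>
  have "greedy_subcode F n C1 C2 r (D r) \<and>
    (\<forall>E. greedy_subcode F n C1 C2 r E \<longrightarrow> wt F n E = rghw F n C1 C2 r)"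
    using r
  proof (induction r)
    case 0
    then show ?case by simp
  next
    case (Suc r)
    \<comment> \<open>The recursion for \<open>greedy_subcode\<close> treats index 1 separately,
      hence the further split of \<open>r\<close>.\<close>
    show ?case
    proof (cases r)
      case 0
      then show ?thesis using chain[of 1] Suc.prems by auto
    next
      case (Suc s)
      have IH: "greedy_subcode F n C1 C2 r (D r)"
        using Suc Suc.IH Suc.prems by auto
      let ?P = "\<lambda>D'. subcode F n D' C1 \<and> code_dim F n D' = Suc r \<and> D' \<inter> C2 = zero_code F n \<and>
             (\<exists>E. greedy_subcode F n C1 C2 r E \<and> E \<subseteq> D')"
      have PD: "?P (D (Suc r))"
        using chain[of "Suc r"] Suc.prems IH incr[of r] Suc by auto
      have wtD: "wt F n (D (Suc r)) = rghw F n C1 C2 (Suc r)"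
        using chain[of "Suc r"] Suc.prems by auto
      have lower: "rghw F n C1 C2 (Suc r) \<le> wt F n E" if "?P E" for E
        using that by (intro rghw_le_wt) auto
      have greedy: "greedy_subcode F n C1 C2 (Suc r) E \<longleftrightarrow> is_arg_min (wt F n) ?P E" for E
        unfolding Suc by (rule greedy_subcode.simps(3))
      show ?thesis
        unfolding greedy is_arg_min_linorder using PD wtD lower by (metis antisym)
    qed
  qed
  then show ?thesis
    unfolding greedy_weight_def by (intro the_equality) auto
qed

end

section \<open>Codes spanned by triangular rows\<close>

text \<open>The matrix with entries \<open>v l (pivot i)\<close> is lower triangular with nonzero
  diagonal; this yields linear independence. Entries lie in the field for all indices, so sums need
  no range conditions.\<close>

locale triangular_rows = finite_field +
  fixes n k :: nat and v :: "nat \<Rightarrow> nat \<Rightarrow> 'a" and pivot :: "nat \<Rightarrow> nat"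
  assumes row_closed [simp]: "v i j \<in> carrier F"
    and pivot_column: "i \<in> {1..k} \<Longrightarrow> pivot i \<in> {1..n}"
    and pivot_nonzero: "i \<in> {1..k} \<Longrightarrow> v i (pivot i) \<noteq> \<zero>"
    and below_pivot: "\<lbrakk>i \<in> {1..k}; l \<in> {1..k}; l < i\<rbrakk> \<Longrightarrow> v l (pivot i) = \<zero>"
begin

definition row_comb :: "nat set \<Rightarrow> (nat \<Rightarrow> 'a) \<Rightarrow> nat \<Rightarrow> 'a" where
  "row_comb I a j = (\<Oplus>i\<in>I. a i \<otimes> v i j)"

text \<open>Extensional coefficient families make it possible to count the span by injectivity of
  this parametrization.\<close>

definition row_span :: "nat set \<Rightarrow> (nat \<Rightarrow> 'a) set" where
  "row_span I = (\<lambda>a. \<lambda>j\<in>{1..n}. row_comb I a j) ` (I \<rightarrow>\<^sub>E carrier F)"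

lemma row_comb_closed: "a \<in> I \<rightarrow> carrier F \<Longrightarrow> row_comb I a j \<in> carrier F"
  unfolding row_comb_def by (rule finsum_closed) auto

text \<open>Rows may be dropped for two reasons, a zero coefficient or a zero entry in column
  \<open>j\<close>; both occur later.\<close>

lemma row_comb_subset:
  assumes "finite I" "J \<subseteq> I" "a \<in> I \<rightarrow> carrier F" "\<And>i. i \<in> I - J \<Longrightarrow> a i = \<zero> \<or> v i j = \<zero>"
  shows "row_comb J a j = row_comb I a j"
  unfolding row_comb_def
proof (rule add.finprod_mono_neutral_cong_left[OF assms(1,2)])
  fix i assume i: "i \<in> I - J"
  then have "a i \<in> carrier F" using assms(3) by auto
  then show "a i \<otimes> v i j = \<zero>" using assms(4)[OF i] by auto
qed (use assms(3) in auto)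

lemma row_comb_cong:
  "(\<And>i. i \<in> I \<Longrightarrow> a i = b i) \<Longrightarrow> b \<in> I \<rightarrow> carrier F \<Longrightarrow> row_comb I a j = row_comb I b j"
  unfolding row_comb_def by (rule finsum_cong') auto

lemma row_comb_in_row_span:
  assumes "a \<in> I \<rightarrow> carrier F"
  shows "(\<lambda>j\<in>{1..n}. row_comb I a j) \<in> row_span I"
proof -
  have "row_comb I (restrict a I) j = row_comb I a j" for j
    by (rule row_comb_cong) (use assms in auto)
  then show ?thesis
    unfolding row_span_def using assms by (intro image_eqI[of _ _ "restrict a I"]) auto
qed

lemma row_span_mono:
  assumes "finite I" "J \<subseteq> I"
  shows "row_span J \<subseteq> row_span I"
proof
  fix c assume "c \<in> row_span J"
  then obtain a where a: "a \<in> J \<rightarrow>\<^sub>E carrier F" "c = (\<lambda>j\<in>{1..n}. row_comb J a j)"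
    unfolding row_span_def by auto
  \<comment> \<open>Coefficients are extended by zero to the larger index set.\<close>
  define b where "b i = (if i \<in> J then a i else \<zero>)" for i
  have b: "b \<in> I \<rightarrow> carrier F"
    using a(1) by (auto simp: b_def)
  have "row_comb J a j = row_comb I b j" for j
  proof -
    have "row_comb J a j = row_comb J b j"
      by (rule row_comb_cong) (use a(1) in \<open>auto simp: b_def\<close>)
    also have "\<dots> = row_comb I b j"
      by (rule row_comb_subset[OF assms b]) (auto simp: b_def)
    finally show ?thesis .
  qed
  then show "c \<in> row_span I"
    using row_comb_in_row_span[OF b] a(2) by simp
qed

lemma row_comb_add:
  assumes "a \<in> I \<rightarrow> carrier F" "b \<in> I \<rightarrow> carrier F"
  shows "row_comb I (\<lambda>i. a i \<oplus> b i) j = row_comb I a j \<oplus> row_comb I b j"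
proof -
  have "(\<Oplus>i\<in>I. (a i \<oplus> b i) \<otimes> v i j) = (\<Oplus>i\<in>I. a i \<otimes> v i j \<oplus> b i \<otimes> v i j)"
    by (rule finsum_cong') (use assms in \<open>auto simp: l_distr Pi_iff\<close>)
  also have "\<dots> = row_comb I a j \<oplus> row_comb I b j"
    unfolding row_comb_def by (rule finsum_addf) (use assms in auto)
  finally show ?thesis
    unfolding row_comb_def .
qed

lemma row_comb_smult:
  assumes "finite I" "a \<in> I \<rightarrow> carrier F" "c \<in> carrier F"
  shows "row_comb I (\<lambda>i. c \<otimes> a i) j = c \<otimes> row_comb I a j"
proof -
  have "(\<Oplus>i\<in>I. c \<otimes> a i \<otimes> v i j) = (\<Oplus>i\<in>I. c \<otimes> (a i \<otimes> v i j))"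
    by (rule finsum_cong') (use assms in \<open>auto simp: m_assoc Pi_iff\<close>)
  also have "\<dots> = c \<otimes> row_comb I a j"
    unfolding row_comb_def by (rule finsum_rdistr[symmetric]) (use assms in auto)
  finally show ?thesis
    unfolding row_comb_def .
qed

lemma linear_code_row_span:
  assumes "finite I"
  shows "linear_code F n (row_span I)"
  unfolding linear_code_iff
proof (intro conjI ballI)
  show "row_span I \<subseteq> {1..n} \<rightarrow>\<^sub>E carrier F"
    by (auto simp: row_span_def PiE_def intro!: row_comb_closed)
  have "row_comb I (\<lambda>_. \<zero>) j = \<zero>" for j
    by (simp add: row_comb_def)
  then show "(\<lambda>j\<in>{1..n}. \<zero>) \<in> row_span I"
    using row_comb_in_row_span[of "\<lambda>_. \<zero>" I] by simp
next
  fix u w assume "u \<in> row_span I" "w \<in> row_span I"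
  then obtain a b where ab: "a \<in> I \<rightarrow> carrier F" "b \<in> I \<rightarrow> carrier F"
    and uw: "u = (\<lambda>j\<in>{1..n}. row_comb I a j)" "w = (\<lambda>j\<in>{1..n}. row_comb I b j)"
    unfolding row_span_def by auto
  have "(\<lambda>j\<in>{1..n}. u j \<oplus> w j) = (\<lambda>j\<in>{1..n}. row_comb I (\<lambda>i. a i \<oplus> b i) j)"
    by (rule restrict_ext) (simp add: uw row_comb_add[OF ab])
  then show "(\<lambda>j\<in>{1..n}. u j \<oplus> w j) \<in> row_span I"
    using row_comb_in_row_span[of "\<lambda>i. a i \<oplus> b i" I] ab by (auto simp: Pi_iff)
next
  fix c u assume c: "c \<in> carrier F" and "u \<in> row_span I"
  then obtain a where a: "a \<in> I \<rightarrow> carrier F" and u: "u = (\<lambda>j\<in>{1..n}. row_comb I a j)"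
    unfolding row_span_def by auto
  have "(\<lambda>j\<in>{1..n}. c \<otimes> u j) = (\<lambda>j\<in>{1..n}. row_comb I (\<lambda>i. c \<otimes> a i) j)"
    by (rule restrict_ext) (simp add: u row_comb_smult[OF assms a c])
  then show "(\<lambda>j\<in>{1..n}. c \<otimes> u j) \<in> row_span I"
    using row_comb_in_row_span[of "\<lambda>i. c \<otimes> a i" I] a c by (auto simp: Pi_iff)
qed

text \<open>The last row with a nonzero coefficient is the only one contributing at its pivot.\<close>

lemma row_comb_nonzero:
  assumes "I \<subseteq> {1..k}" "a \<in> I \<rightarrow> carrier F" "i \<in> I" "a i \<noteq> \<zero>"
  obtains l where "l \<in> I" "row_comb I a (pivot l) \<noteq> \<zero>"
proof -
  have fin: "finite I"
    using assms(1) finite_subset by blast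
  let ?S = "{i \<in> I. a i \<noteq> \<zero>}"
  define l where "l = Max ?S"
  have "l \<in> ?S"
    unfolding l_def using fin assms(3,4) by (intro Max_in) auto
  then have l: "l \<in> I" "a l \<noteq> \<zero>" by auto
  have al: "a l \<in> carrier F" using l assms(2) by auto
  have gt: "a i' = \<zero>" if "i' \<in> I" "l < i'" for i'
    using Max_ge[of ?S i'] that fin by (auto simp flip: l_def)
  have "row_comb {l} a (pivot l) = row_comb I a (pivot l)"
  proof (rule row_comb_subset[OF fin _ assms(2)])
    fix i' assume i': "i' \<in> I - {l}"
    show "a i' = \<zero> \<or> v i' (pivot l) = \<zero>"
    proof (cases "i' < l")
      case True
      then show ?thesis using below_pivot[of l i'] i' l assms(1) by (meson DiffD1 subsetD)
    next
      case False
      then show ?thesis using gt[of i'] i' by auto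
    qed
  qed (use l in auto)
  also have "row_comb {l} a (pivot l) = a l \<otimes> v l (pivot l)"
    using al by (simp add: row_comb_def)
  finally have "row_comb I a (pivot l) \<noteq> \<zero>"
    using l al assms(1) pivot_nonzero[of l] by (auto simp: integral_iff)
  with l(1) show thesis by (rule that)
qed

text \<open>If two distinct coefficient families gave the same word, their difference would produce
  a nonzero entry at some pivot. Pivots lie in \<open>{1..n}\<close>, so the two words would differ
  there. The span is therefore counted by coefficient families.\<close>

lemma code_dim_row_span:
  assumes "I \<subseteq> {1..k}"
  shows "code_dim F n (row_span I) = card I"
proof (rule code_dim_eqI)
  have fin: "finite I"
    using assms finite_subset by blast
  show "linear_code F n (row_span I)"
    by (rule linear_code_row_span[OF fin])
  have "inj_on (\<lambda>a. \<lambda>j\<in>{1..n}. row_comb I a j) (I \<rightarrow>\<^sub>E carrier F)"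
  proof (rule inj_onI, rule ccontr)
    fix a b assume ab: "a \<in> I \<rightarrow>\<^sub>E carrier F" "b \<in> I \<rightarrow>\<^sub>E carrier F" and "a \<noteq> b"
      and eq: "(\<lambda>j\<in>{1..n}. row_comb I a j) = (\<lambda>j\<in>{1..n}. row_comb I b j)"
    then obtain i where i: "i \<in> I" "a i \<noteq> b i"
      by (metis PiE_ext)
    have ab': "a \<in> I \<rightarrow> carrier F" "b \<in> I \<rightarrow> carrier F"
      using ab by auto
    have nb: "(\<lambda>i. \<ominus> \<one> \<otimes> b i) \<in> I \<rightarrow> carrier F"
      using ab'(2) by auto
    \<comment> \<open>The difference is written as a sum with a multiple by
      \<open>\<ominus> \<one>\<close>, so that additivity and homogeneity of \<open>row_comb\<close>
      apply.\<close>
    let ?c = "\<lambda>i. a i \<oplus> \<ominus> \<one> \<otimes> b i"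
    have "?c i = a i \<ominus> b i"
      using i(1) ab'(2) by (auto simp: a_minus_def l_minus Pi_iff)
    then have "?c i \<noteq> \<zero>"
      using i ab' by (auto simp: Pi_iff)
    then obtain l where l: "l \<in> I" "row_comb I ?c (pivot l) \<noteq> \<zero>"
      using row_comb_nonzero[OF assms, of ?c i] i(1) ab' nb by (auto simp: Pi_iff)
    have "pivot l \<in> {1..n}"
      using l(1) assms pivot_column by auto
    then have "row_comb I a (pivot l) = row_comb I b (pivot l)"
      using fun_cong[OF eq, of "pivot l"] by simp
    moreover have "row_comb I b (pivot l) \<in> carrier F"
      using ab'(2) by (rule row_comb_closed)
    ultimately have "row_comb I ?c (pivot l) = \<zero>"
      unfolding row_comb_add[OF ab'(1) nb] row_comb_smult[OF fin ab'(2) a_inv_closed[OF one_closed]]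
      by (simp add: l_minus r_neg)
    with l(2) show False by blast
  qed
  then have "card (row_span I) = card (I \<rightarrow>\<^sub>E carrier F)"
    unfolding row_span_def by (rule card_image)
  then show "card (row_span I) = card (carrier F) ^ card I"
    by (simp add: card_PiE fin)
qed

lemma row_span_vanish:
  assumes "c \<in> row_span I" "\<And>i. i \<in> I \<Longrightarrow> v i j = \<zero>" "j \<in> {1..n}"
  shows "c j = \<zero>"
proof -
  obtain a where a: "a \<in> I \<rightarrow> carrier F" "c = (\<lambda>j\<in>{1..n}. row_comb I a j)"
    using assms(1) unfolding row_span_def by auto
  have "row_comb I a j = (\<Oplus>i\<in>I. \<zero>)"
    unfolding row_comb_def by (rule finsum_cong') (use a(1) assms(2) in \<open>auto simp: Pi_iff\<close>)
  then show ?thesis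
    using a(2) assms(3) by simp
qed

end

section \<open>The construction\<close>

text \<open>The length is written \<open>N + k2\<close> to avoid truncated subtraction. The chain
  \<open>D\<close> belongs to the conclusion because the chain condition and the greedy weights are
  both derived from it.\<close>

lemma (in finite_field) codes_with_given_rghw:
  fixes d :: "nat \<Rightarrow> nat"
  assumes "1 \<le> m" "1 \<le> d 1" "strict_mono_on {1..m} d" "d m \<le> N" "N \<le> card (carrier F)"
  shows "\<exists>C1 C2 D. nested_codes F (N + k2) C1 C2 \<and>
    code_dim F (N + k2) C1 = m + k2 \<and> code_dim F (N + k2) C2 = k2 \<and>
    (\<forall>r\<in>{1..m}. subcode F (N + k2) (D r) C1 \<and> D r \<inter> C2 = zero_code F (N + k2) \<and>
       code_dim F (N + k2) (D r) = r \<and> wt F (N + k2) (D r) = rghw F (N + k2) C1 C2 r \<and>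
       rghw F (N + k2) C1 C2 r = d r) \<and>
    (\<forall>r\<in>{1..<m}. D r \<subseteq> D (Suc r))"
proof -
  have d_less: "d i < d l" if "1 \<le> i" "i < l" "l \<le> m" for i l
    using assms(3) that by (auto simp: strict_mono_on_def)
  have d_le: "d i \<le> d l" if "1 \<le> i" "i \<le> l" "l \<le> m" for i l
    using d_less[of i l] that by (cases "i = l") auto
  have d_range: "1 \<le> d i" "d i \<le> N" if "1 \<le> i" "i \<le> m" for i
    using d_le[of 1 i] d_le[of i m] that assms(2,4) by auto
  \<comment> \<open>The field size bound supplies enough distinct evaluation points.\<close>
  obtain x where x: "x ` {1..N} \<subseteq> carrier F" "inj_on x {1..N}"
    using card_le_inj[of "{1..N}" "carrier F"] assms(5) by auto
  have xc: "x t \<in> carrier F" if "1 \<le> t" "t \<le> N" for t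
    using x(1) that by auto
  \<comment> \<open>For \<open>d i = N\<close> the product is empty and \<open>P i\<close> is the
    constant 1.\<close>
  define P where "P i y = (\<Otimes>t\<in>{d i<..N}. y \<ominus> x t)" for i y
  have P_closed: "P i y \<in> carrier F" if "1 \<le> i" "i \<le> m" "y \<in> carrier F" for i y
    unfolding P_def by (rule finprod_closed) (use that xc in auto)
  have P_poly: "poly_fun (N - d i) (P i)" if "1 \<le> i" "i \<le> m" for i
  proof -
    have "poly_fun (card {d i<..N}) (P i)"
      unfolding P_def
    proof (rule poly_fun_finprod)
      show "poly_fun 1 (\<lambda>y. y \<ominus> x t)" if "t \<in> {d i<..N}" for t
        using that by (intro poly_fun_linear xc) auto
    qed (use xc in auto)
    then show ?thesis by simp
  qed
  have P_zero: "P i (x j) = \<zero>" if "1 \<le> i" "i \<le> m" "d i < j" "j \<le> N" for i j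
  proof -
    \<comment> \<open>The factor with \<open>t = j\<close> is split off; it is zero.\<close>
    have "P i (x j) = (x j \<ominus> x j) \<otimes> (\<Otimes>t\<in>{d i<..N} - {j}. x j \<ominus> x t)"
      unfolding P_def using that xc
      by (subst finprod_insert[symmetric]) (auto simp: insert_absorb)
    then show ?thesis
      using that xc by (auto simp: r_neg a_minus_def)
  qed
  have prod_nonzero: "(\<Otimes>t\<in>T. g t) \<noteq> \<zero>"
    if "finite T" "\<And>t. t \<in> T \<Longrightarrow> g t \<in> carrier F - {\<zero>}" for T :: "nat set" and g
    using that by (induction T rule: finite_induct) (auto simp: integral_iff Pi_iff)
  have P_nonzero: "P i (x j) \<noteq> \<zero>" if "1 \<le> j" "j \<le> d i" "1 \<le> i" "i \<le> m" for i j
    unfolding P_def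
  proof (rule prod_nonzero)
    fix t assume t: "t \<in> {d i<..N}"
    then have "x j \<noteq> x t"
      using inj_onD[OF x(2), of j t] that d_range[of i] by auto
    then show "x j \<ominus> x t \<in> carrier F - {\<zero>}"
      using that t xc[of j] xc[of t] d_range[of i] by auto
  qed simp
  define n where "n = N + k2"
  \<comment> \<open>The first \<open>m\<close> rows are evaluations padded with zeros after column
    \<open>N\<close>; row \<open>m + s\<close> is the unit vector at column
    \<open>N + s\<close>.\<close>
  define v where "v i j = (if i \<in> {1..m} then if j \<in> {1..N} then P i (x j) else \<zero>
    else if j + m = N + i then \<one> else \<zero>)" for i j
  \<comment> \<open>\<open>P i\<close> is nonzero at \<open>x (d i)\<close>, whereas
    \<open>P l\<close> with \<open>l < i\<close> vanishes there because \<open>d l < d i\<close>. A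
    unit vector has its pivot at its only nonzero column.\<close>
  define pivot where "pivot i = (if i \<le> m then d i else N + i - m)" for i
  interpret triangular_rows F n "m + k2" v pivot
  proof unfold_locales
    fix i l assume "i \<in> {1..m + k2}" "l \<in> {1..m + k2}" "l < i"
    then show "v l (pivot i) = \<zero>"
      using P_zero[of l "d i"] d_less[of l i] d_range[of i] by (auto simp: v_def pivot_def)
  next
    fix i assume i: "i \<in> {1..m + k2}"
    show "pivot i \<in> {1..n}"
      using i d_range[of i] assms(1) by (auto simp: pivot_def n_def)
    show "v i (pivot i) \<noteq> \<zero>"
      using i d_range[of i] P_nonzero[of "d i" i] by (auto simp: v_def pivot_def)
  next
    show "v i j \<in> carrier F" for i j
      using P_closed[of i "x j"] xc[of j] by (auto simp: v_def)
  qed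
  define C1 where "C1 = row_span {1..m + k2}"
  define C2 where "C2 = row_span {m + 1..m + k2}"
  define D where "D r = row_span {1..r}" for r
  have dimC1: "code_dim F n C1 = m + k2"
    unfolding C1_def by (subst code_dim_row_span) auto
  have dimC2: "code_dim F n C2 = k2"
    unfolding C2_def by (subst code_dim_row_span) auto
  have dimD: "code_dim F n (D r) = r" if "r \<le> m" for r
    unfolding D_def by (subst code_dim_row_span) (use that in auto)
  have subcode_span: "subcode F n (row_span I) C1" if "I \<subseteq> {1..m + k2}" for I
    unfolding subcode_def C1_def
    by (intro conjI linear_code_row_span row_span_mono that finite_subset[OF that]) simp_all
  have nested: "nested_codes F n C1 C2"
  proof -
    have "C2 \<noteq> C1"
      using dimC1 dimC2 assms(1) by auto
    then show ?thesis
      using subcode_span[of "{1..m + k2}"] subcode_span[of "{m + 1..m + k2}"]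
      unfolding nested_codes_def subcode_def C1_def C2_def by auto
  qed
  \<comment> \<open>Words of \<open>C2\<close> vanish on the first \<open>N\<close> columns, words
    of \<open>D r\<close> on the remaining ones.\<close>
  have D_C2: "D r \<inter> C2 = zero_code F n" if "r \<le> m" for r
  proof
    show "zero_code F n \<subseteq> D r \<inter> C2"
      using linear_code_row_span unfolding zero_code_eq linear_code_iff D_def C2_def by auto
    show "D r \<inter> C2 \<subseteq> zero_code F n"
    proof
      fix c assume c: "c \<in> D r \<inter> C2"
      have "c j = \<zero>" if j: "j \<in> {1..n}" for j
      proof (cases "j \<le> N")
        case True
        have "v i j = \<zero>" if "i \<in> {m + 1..m + k2}" for i
          using that True by (auto simp: v_def)
        then show ?thesis
          using row_span_vanish[of c "{m + 1..m + k2}" j] c j unfolding C2_def by blast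
      next
        case False
        have "v i j = \<zero>" if "i \<in> {1..r}" for i
          using that False \<open>r \<le> m\<close> by (auto simp: v_def)
        then show ?thesis
          using row_span_vanish[of c "{1..r}" j] c j unfolding D_def by blast
      qed
      moreover have "c \<in> {1..n} \<rightarrow>\<^sub>E carrier F"
        using c linear_code_row_span[of "{1..r}"] unfolding linear_code_iff D_def by blast
      ultimately show "c \<in> zero_code F n"
        unfolding zero_code_eq by (auto simp: fun_eq_iff PiE_def extensional_def)
    qed
  qed
  \<comment> \<open>For \<open>i \<le> r\<close>, columns from \<open>d r + 1\<close> to
    \<open>N\<close> are roots of \<open>P i\<close>, as \<open>d i \<le> d r\<close>; later columns
    are padding. Equality follows once the lower bound is applied to \<open>D r\<close>.\<close>
  have wt_D: "wt F n (D r) \<le> d r" if r: "r \<in> {1..m}" for r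
  proof -
    have "j \<in> {1..d r}" if "j \<in> {1..n}" "c \<in> D r" "c j \<noteq> \<zero>" for j c
    proof (rule ccontr)
      assume j: "j \<notin> {1..d r}"
      have "v i j = \<zero>" if "i \<in> {1..r}" for i
        using that j r \<open>j \<in> {1..n}\<close> d_le[of i r] P_zero[of i j] by (auto simp: v_def)
      then show False
        using row_span_vanish[of c "{1..r}" j] that unfolding D_def by blast
    qed
    then have "card (supp F n (D r)) \<le> card {1..d r}"
      by (intro card_mono) (auto simp: supp_def)
    then show ?thesis by (simp add: wt_def)
  qed
  have lower: "d r \<le> wt F n E"
    if r: "r \<in> {1..m}" and E: "subcode F n E C1" "E \<inter> C2 = zero_code F n" "r \<le> code_dim F n E" for r E
  proof -
    \<comment> \<open>These rows span dimension \<open>m + k2 + 1 - r\<close>; together with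
      dimension at least \<open>r\<close> for \<open>E\<close>, this exceeds \<open>m + k2\<close>
      by at least one.\<close>
    let ?W = "{r..m + k2}"
    have dimW: "code_dim F n (row_span ?W) = m + k2 + 1 - r"
      using r by (subst code_dim_row_span) auto
    have "code_dim F n C1 < code_dim F n E + code_dim F n (row_span ?W)"
      using dimC1 dimW E(3) r by auto
    then obtain c where c: "c \<in> E" "c \<in> row_span ?W" "c \<notin> zero_code F n"
      using subcodes_meet_nontrivially[of n C1 E "row_span ?W"] nested E(1) subcode_span[of ?W] r
      by (auto simp: nested_codes_def)
    obtain a where a: "a \<in> ?W \<rightarrow> carrier F" "c = (\<lambda>j\<in>{1..n}. row_comb ?W a j)"
      using c(2) unfolding row_span_def by auto
    \<comment> \<open>Otherwise only unit vectors would contribute, and the nonzero word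
      \<open>c\<close> would lie in both \<open>E\<close> and \<open>C2\<close>.\<close>
    have "\<exists>i\<in>{r..m}. a i \<noteq> \<zero>"
    proof (rule ccontr)
      assume *: "\<not> ?thesis"
      have "row_comb {m + 1..m + k2} a j = row_comb ?W a j" for j
        by (rule row_comb_subset[OF _ _ a(1)]) (use * r in auto)
      then have "c \<in> C2"
        using row_comb_in_row_span[of a "{m + 1..m + k2}"] a r unfolding C2_def by (auto simp: Pi_iff)
      then show False
        using c E(2) by blast
    qed
    then obtain i where i: "i \<in> {r..m}" "a i \<noteq> \<zero>" by blast
    have a': "a \<in> {r..m} \<rightarrow> carrier F"
      using a(1) by auto
    define f where "f y = (\<Oplus>i\<in>{r..m}. a i \<otimes> P i y)" for y
    have "poly_fun (N - d r) f"
      unfolding f_def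
    proof (rule poly_fun_finsum)
      fix i assume i: "i \<in> {r..m}"
      have "poly_fun (0 + (N - d i)) (\<lambda>y. a i \<otimes> P i y)"
        using i r a' by (intro poly_fun_mult poly_fun_const P_poly) auto
      \<comment> \<open>A larger index means a larger \<open>d i\<close> and hence a smaller degree,
        so \<open>P r\<close> has the largest degree in the sum.\<close>
      moreover have "0 + (N - d i) \<le> N - d r"
        using d_le[of r i] i r by auto
      ultimately show "poly_fun (N - d r) (\<lambda>y. a i \<otimes> P i y)"
        by (rule poly_fun_mono)
      show "a i \<otimes> P i y \<in> carrier F" if "y \<in> carrier F" for y
        using i r a' P_closed[of i y] that by auto
    qed simp
    have f_comb: "f (x j) = row_comb {r..m} a j" if "j \<in> {1..N}" for j
      unfolding f_def row_comb_def
      by (rule finsum_cong') (use that r a' in \<open>auto simp: v_def Pi_iff intro!: m_closed P_closed xc\<close>)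
    \<comment> \<open>The unit vectors contribute nothing in the first \<open>N\<close>
      columns.\<close>
    have c_f: "c j = f (x j)" if j: "j \<in> {1..N}" for j
    proof -
      have "row_comb {r..m} a j = row_comb ?W a j"
        by (rule row_comb_subset[OF _ _ a(1)]) (use j in \<open>auto simp: v_def\<close>)
      then show ?thesis
        using j a(2) by (simp add: f_comb n_def)
    qed
    \<comment> \<open>Since \<open>l \<le> m\<close>, the pivot is \<open>d l\<close>, so
      \<open>x (d l)\<close> is the point at which \<open>f\<close> is seen to be nonzero.\<close>
    obtain l where l: "l \<in> {r..m}" "row_comb {r..m} a (pivot l) \<noteq> \<zero>"
      using row_comb_nonzero[OF _ a' i] r by auto
    have "f (x (d l)) \<noteq> \<zero>"
      using l r d_range[of l] f_comb[of "d l"] by (auto simp: pivot_def)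
    then have roots: "card {y \<in> carrier F. f y = \<zero>} \<le> N - d r"
      using poly_fun_card_roots_le[OF finite_carrier \<open>poly_fun (N - d r) f\<close>, of "x (d l)"]
        xc[of "d l"] d_range[of l] l r by auto
    \<comment> \<open>The map \<open>x\<close> sends zeros of \<open>c\<close> among the first
      \<open>N\<close> columns injectively to roots of \<open>f\<close>. At most
      \<open>N - d r\<close> columns are lost, and the other columns lie in the support of
      \<open>E\<close>.\<close>
    let ?Z = "{j \<in> {1..N}. c j = \<zero>}"
    have "card ?Z = card (x ` ?Z)"
      using x(2) by (intro card_image[symmetric]) (auto intro: inj_on_subset)
    also have "\<dots> \<le> card {y \<in> carrier F. f y = \<zero>}"
      using xc c_f by (intro card_mono) auto
    finally have "card ?Z \<le> N - d r"
      using roots by linarith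
    then have "d r \<le> card {1..N} - card ?Z"
      using d_range[of r] r by auto
    also have "\<dots> = card ({1..N} - ?Z)"
      by (rule card_Diff_subset[symmetric]) auto
    also have "\<dots> \<le> card (supp F n E)"
      using c(1) by (intro card_mono) (auto simp: supp_def n_def)
    finally show ?thesis
      by (simp add: wt_def)
  qed
  have D_subcode: "subcode F n (D r) C1" if "r \<in> {1..m}" for r
    unfolding D_def using that by (intro subcode_span) auto
  have wt_eq: "wt F n (D r) = d r" if "r \<in> {1..m}" for r
    using wt_D[of r] lower[of r "D r"] that D_subcode D_C2 dimD by (simp add: antisym)
  have rghw: "rghw F n C1 C2 r = wt F n (D r)" if "r \<in> {1..m}" for r
    using that D_subcode D_C2 dimD lower wt_eq by (intro rghw_eqI) auto
  have "D r \<subseteq> D (Suc r)" for r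
    unfolding D_def by (rule row_span_mono) auto
  then show ?thesis
    using nested dimC1 dimC2 D_subcode D_C2 dimD rghw wt_eq unfolding n_def[symmetric]
    by (intro exI[of _ C1] exI[of _ C2] exI[of _ D]) simp
qed

section \<open>The chain condition and sequences over prime fields\<close>

text \<open>Strictness of the inclusions comes from the differing dimensions; at the start,
  \<open>D 1\<close> has as many elements as the field, hence more than one.\<close>

lemma (in finite_field) relative_chain_conditionI:
  assumes "code_dim F n C1 - code_dim F n C2 = m" "1 \<le> m"
    and chain: "\<And>r. r \<in> {1..m} \<Longrightarrow> subcode F n (D r) C1 \<and> D r \<inter> C2 = zero_code F n \<and>
       code_dim F n (D r) = r \<and> wt F n (D r) = rghw F n C1 C2 r"
    and incr: "\<And>r. r \<in> {1..<m} \<Longrightarrow> D r \<subseteq> D (Suc r)"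
  shows "relative_chain_condition F n C1 C2"
proof -
  have "D r \<subset> D (Suc r)" if "r \<in> {1..<m}" for r
    using incr[OF that] chain[of r] chain[of "Suc r"] that by force
  moreover have "zero_code F n \<subset> D 1"
  proof -
    have D1: "linear_code F n (D 1)" "code_dim F n (D 1) = 1"
      using chain[of 1] assms(2) by (auto simp: subcode_def)
    then have "card (D 1) \<noteq> card (zero_code F n)"
      using card_linear_code[OF D1(1)] card_carrier_gt_1 by simp
    then have "zero_code F n \<noteq> D 1" by metis
    moreover have "(\<lambda>j\<in>{1..n}. \<zero>) \<in> D 1"
      using D1(1) by (simp only: linear_code_iff)
    ultimately show ?thesis
      unfolding zero_code_eq by (simp only: psubset_eq insert_subset empty_subsetI simp_thms)
  qed
  ultimately show ?thesis
    unfolding relative_chain_condition_def Let_def assms(1) using chain by (intro exI[of _ D]) simp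
qed

text \<open>A prime above the last entry gives a residue field with enough points. The construction
  is used with \<open>k2 = 0\<close> and \<open>N = last ds\<close>, so the length is the last
  entry.\<close>

lemma prime_field_codes:
  assumes "ds \<noteq> []" "sorted_wrt (<) ds" "\<forall>x\<in>set ds. 0 < x"
  shows "\<exists>(F :: int ring) n C1 C2. field F \<and> nested_codes F n C1 C2 \<and>
    rghw_seq F n C1 C2 = ds \<and> relative_chain_condition F n C1 C2 \<and> greedy_weight_seq F n C1 C2 = ds"
proof -
  obtain p where p: "prime p" "last ds < p"
    using bigger_prime by blast
  interpret residues_prime p "residue_ring (int p)"
    by (simp add: residues_prime_def p(1))
  let ?F = "residue_ring (int p)"
  have car: "carrier ?F = {0..int p - 1}"
    by (simp add: residue_ring_def)
  interpret finite_field ?F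
    by unfold_locales (simp add: car)
  define m where "m = length ds"
  \<comment> \<open>Lists are indexed from 0, weights from 1.\<close>
  define d where "d i = ds ! (i - 1)" for i
  have m: "1 \<le> m"
    using assms(1) by (cases ds) (auto simp: m_def)
  have mono: "strict_mono_on {1..m} d"
    unfolding d_def m_def
    by (intro strict_mono_onI sorted_wrt_nth_less[OF assms(2)]) auto
  have card_le: "last ds \<le> card (carrier ?F)"
    using p(2) car by simp
  have d1: "1 \<le> d 1"
    using assms(1,3) by (auto simp: d_def Suc_le_eq)
  have dm: "d m \<le> last ds"
    using assms(1) by (simp add: d_def m_def last_conv_nth)
  obtain C1 C2 D where C: "nested_codes ?F (last ds) C1 C2"
    "code_dim ?F (last ds) C1 = m" "code_dim ?F (last ds) C2 = 0"
    "\<forall>r\<in>{1..m}. subcode ?F (last ds) (D r) C1 \<and> D r \<inter> C2 = zero_code ?F (last ds) \<and>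
       code_dim ?F (last ds) (D r) = r \<and> wt ?F (last ds) (D r) = rghw ?F (last ds) C1 C2 r \<and>
       rghw ?F (last ds) C1 C2 r = d r"
    "\<forall>r\<in>{1..<m}. D r \<subseteq> D (Suc r)"
    using codes_with_given_rghw[where ?k2.0 = 0, OF m d1 mono dm card_le]
    unfolding add_0_right by (elim exE conjE) (rule that)
  have ds: "map f [1..<Suc m] = ds" if "\<And>r. r \<in> {1..m} \<Longrightarrow> f r = d r" for f
    by (rule nth_equalityI) (use that in \<open>auto simp: m_def d_def simp del: upt_Suc\<close>)
  have "relative_chain_condition ?F (last ds) C1 C2"
    using relative_chain_conditionI[of "last ds" C1 C2 m D] C m by simp
  moreover have "rghw_seq ?F (last ds) C1 C2 = ds"
    unfolding rghw_seq_def C(2,3) diff_zero using C(4) by (intro ds) simp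
  moreover have "greedy_weight_seq ?F (last ds) C1 C2 = ds"
    unfolding greedy_weight_seq_def C(2,3) diff_zero
    using C(4,5) greedy_weight_eq_rghw[of m "last ds" D C1 C2] by (intro ds) simp
  ultimately show ?thesis
    using C(1) is_field by (intro exI[of _ ?F] exI[of _ "last ds"] exI[of _ C1] exI[of _ C2]) simp
qed

theorem theorem3p10:
  shows
    "(\<forall>ds :: nat list. ds \<noteq> [] \<and> sorted_wrt (<) ds \<and> (\<forall>x\<in>set ds. 0 < x) \<longrightarrow>
        (\<exists>(F :: int ring) n C1 C2. field F \<and> nested_codes F n C1 C2 \<and>
           rghw_seq F n C1 C2 = ds \<and> relative_chain_condition F n C1 C2))
     \<and>
     (\<forall>(n :: nat) (k1 :: nat) (k2 :: nat) (d :: nat \<Rightarrow> nat) (q :: nat) (F :: 'a ring).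
        k2 < k1 \<and> k1 \<le> n \<and>
        1 \<le> d 1 \<and> strict_mono_on {1..k1 - k2} d \<and>
        primepow q \<and> q \<ge> n - k2 \<and> n - k2 \<ge> d (k1 - k2) \<and>
        field F \<and> card (carrier F) = q \<longrightarrow>
        (\<exists>C1 C2. nested_codes F n C1 C2 \<and> code_dim F n C1 = k1 \<and> code_dim F n C2 = k2 \<and>
           (\<forall>r\<in>{1..k1 - k2}. rghw F n C1 C2 r = d r) \<and>
           relative_chain_condition F n C1 C2))
     \<and>
     (\<forall>ds :: nat list. ds \<noteq> [] \<and> sorted_wrt (<) ds \<and> (\<forall>x\<in>set ds. 0 < x) \<longrightarrow>
        (\<exists>(F :: int ring) n C1 C2. field F \<and> nested_codes F n C1 C2 \<and>
           greedy_weight_seq F n C1 C2 = ds))"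
proof (intro conjI allI impI)
  fix ds :: "nat list"
  assume "ds \<noteq> [] \<and> sorted_wrt (<) ds \<and> (\<forall>x\<in>set ds. 0 < x)"
  then obtain F :: "int ring" and n C1 C2 where "field F" "nested_codes F n C1 C2"
    "rghw_seq F n C1 C2 = ds" "relative_chain_condition F n C1 C2" "greedy_weight_seq F n C1 C2 = ds"
    using prime_field_codes[of ds] by (elim conjE) auto
  then show "\<exists>(F :: int ring) n C1 C2. field F \<and> nested_codes F n C1 C2 \<and>
      rghw_seq F n C1 C2 = ds \<and> relative_chain_condition F n C1 C2"
    by (intro exI[of _ F] exI[of _ n] exI[of _ C1] exI[of _ C2]) simp
next
  fix n k1 k2 q :: nat and d :: "nat \<Rightarrow> nat" and F :: "'a ring"
  assume *: "k2 < k1 \<and> k1 \<le> n \<and>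
        1 \<le> d 1 \<and> strict_mono_on {1..k1 - k2} d \<and>
        primepow q \<and> q \<ge> n - k2 \<and> n - k2 \<ge> d (k1 - k2) \<and>
        field F \<and> card (carrier F) = q"
  define m N where "m = k1 - k2" and "N = n - k2"
  \<comment> \<open>Infinite sets have cardinality 0 by convention, so positivity of
    \<open>q\<close> yields a finite field.\<close>
  have "0 < q"
    using * primepow_gt_0_nat by auto
  then have "finite (carrier F)"
    using * card_ge_0_finite by blast
  then interpret finite_field F
    using * by (simp add: finite_field_def finite_field_axioms_def)
  \<comment> \<open>Because \<open>k2 < k1 \<le> n\<close>, the subtractions defining
    \<open>m\<close> and \<open>N\<close> are not truncated.\<close>
  have n: "N + k2 = n" and k1: "m + k2 = k1" and m: "1 \<le> m"
    using * by (auto simp: m_def N_def)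
  obtain C1 C2 D where C: "nested_codes F n C1 C2" "code_dim F n C1 = k1" "code_dim F n C2 = k2"
    "\<forall>r\<in>{1..m}. subcode F n (D r) C1 \<and> D r \<inter> C2 = zero_code F n \<and>
       code_dim F n (D r) = r \<and> wt F n (D r) = rghw F n C1 C2 r \<and> rghw F n C1 C2 r = d r"
    "\<forall>r\<in>{1..<m}. D r \<subseteq> D (Suc r)"
  proof -
    have "1 \<le> d 1" "strict_mono_on {1..m} d" "d m \<le> N" "N \<le> card (carrier F)"
      using * by (simp_all add: m_def N_def)
    from codes_with_given_rghw[OF m this, of k2] show thesis
      unfolding n k1 by (elim exE conjE) (rule that)
  qed
  have "relative_chain_condition F n C1 C2"
    using relative_chain_conditionI[of n C1 C2 m D] C m m_def by simp
  then show "\<exists>C1 C2. nested_codes F n C1 C2 \<and> code_dim F n C1 = k1 \<and> code_dim F n C2 = k2 \<and>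
           (\<forall>r\<in>{1..k1 - k2}. rghw F n C1 C2 r = d r) \<and>
           relative_chain_condition F n C1 C2"
    using C unfolding m_def by (intro exI[of _ C1] exI[of _ C2]) simp
next
  fix ds :: "nat list"
  assume "ds \<noteq> [] \<and> sorted_wrt (<) ds \<and> (\<forall>x\<in>set ds. 0 < x)"
  then obtain F :: "int ring" and n C1 C2 where "field F" "nested_codes F n C1 C2"
    "rghw_seq F n C1 C2 = ds" "relative_chain_condition F n C1 C2" "greedy_weight_seq F n C1 C2 = ds"
    using prime_field_codes[of ds] by (elim conjE) auto
  then show "\<exists>(F :: int ring) n C1 C2. field F \<and> nested_codes F n C1 C2 \<and>
      greedy_weight_seq F n C1 C2 = ds"
    by (intro exI[of _ F] exI[of _ n] exI[of _ C1] exI[of _ C2]) simp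
qed

end
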